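(* Let $m\in\mathbb{N}$, $m\ge1$, let $C\subseteq[2m]$ with $|C|=m$, let $B:=[2m]\setminus C$, and let $\prec$ be a total order on $[2m]$. Then $N(B,C)_\prec$ is a bicompatible subgroup of $S([2m]^2)$ isomorphic to $S_{m^2}\times(\mathbb{Z}_m)^{\times2}$.
   Context: $[n]=\{1,\dots,n\}$; $S(A)$ is the symmetric group on a set $A$, $S_n=S([n])$; permutations are written in disjoint cycle form and composed right to left. For $u\in S([n]^t)$ and $v\in S([n]^r)$, $u\otimes v\in S([n]^{t+r})$ is $(u\otimes v)(\alpha,\beta)=(u(\alpha),v(\beta))$; $1$ is the identity of $S_n$. For $u,v\in S([n]^2)$, $u$ is compatible with $v$ if $(v\otimes1)(1\otimes u)=(1\otimes u)(v\otimes1)$ in $S([n]^3)$; $u$ and $v$ are bicompatible if each is compatible with the other. A subgroup $S\le S([n]^2)$ is a bicompatible subgroup if $u$ and $v$ are bicompatible for all $u,v\in S$ (including $u=v$). Write $C=\{c_1,\dots,c_m\}$ with $c_1\prec\cdots\prec c_m$ and $B=\{b_1,\dots,b_m\}$ with $b_1\prec\cdots\prec b_m$. Define $c_0,r_0\in S([2m]^2)$ by $$c_0:=\prod_{y\in C}\big((c_1,y),\dots,(c_m,y)\big),\qquad r_0:=\prod_{x\in B}\big((x,b_1),\dots,(x,b_m)\big)$$ (products of $m$-cycles). Then $N(B,C)_\prec$ is the subgroup of $S([2m]^2)$ generated by $c_0$, $r_0$ and $S(C\times B)$, where $S(C\times B)$ is embedded in $S([2m]^2)$ as the permutations fixing every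 point outside $C\times B$. *)

theory Defs
  imports "HOL-Algebra.Sym_Groups" "HOL-Algebra.Elementary_Groups"
begin

text \<open>
  A permutation of a set \<open>A\<close> is a total function that \<open>permutes A\<close>, i.e. it is the identity
  outside \<open>A\<close>; for \<open>A \<subseteq> A'\<close> the embedding of \<open>S(A)\<close> into \<open>S(A')\<close> is therefore the inclusion.
  For \<open>A = {1..n}\<close> the group below is the library's \<open>sym_group n\<close>.
\<close>

definition sym_group_on :: "'a set \<Rightarrow> ('a \<Rightarrow> 'a) monoid" where
  "sym_group_on A = \<lparr> carrier = {p. p permutes A}, mult = (\<circ>), one = id \<rparr>"

abbreviation pairs :: "nat \<Rightarrow> (nat \<times> nat) set" where
  "pairs n \<equiv> {1..n} \<times> {1..n}"

abbreviation triples :: "nat \<Rightarrow> (nat \<times> nat \<times> nat) set" where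
  "triples n \<equiv> {1..n} \<times> {1..n} \<times> {1..n}"

text \<open>
  The two tensor products \<open>v \<otimes> 1\<close> and \<open>1 \<otimes> u\<close>, acting on triples \<open>(x, y, z) = (x, (y, z))\<close>.
  They represent elements of \<open>S([n]^3)\<close> on \<open>triples n\<close> only; elsewhere \<open>v \<otimes> 1\<close> need not be
  the identity, so compatibility compares values on \<open>triples n\<close>.
\<close>

definition tensor_one :: "(nat \<times> nat \<Rightarrow> nat \<times> nat) \<Rightarrow> nat \<times> nat \<times> nat \<Rightarrow> nat \<times> nat \<times> nat" where
  "tensor_one v = (\<lambda>(x, y, z). case v (x, y) of (x', y') \<Rightarrow> (x', y', z))"

definition one_tensor :: "(nat \<times> nat \<Rightarrow> nat \<times> nat) \<Rightarrow> nat \<times> nat \<times> nat \<Rightarrow> nat \<times> nat \<times> nat" where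
  "one_tensor u = (\<lambda>(x, y, z). (x, u (y, z)))"

definition compatible :: "nat \<Rightarrow> (nat \<times> nat \<Rightarrow> nat \<times> nat) \<Rightarrow> (nat \<times> nat \<Rightarrow> nat \<times> nat) \<Rightarrow> bool" where
  "compatible n u v \<longleftrightarrow>
     (\<forall>t \<in> triples n. (tensor_one v \<circ> one_tensor u) t = (one_tensor u \<circ> tensor_one v) t)"

definition bicompatible :: "nat \<Rightarrow> (nat \<times> nat \<Rightarrow> nat \<times> nat) \<Rightarrow> (nat \<times> nat \<Rightarrow> nat \<times> nat) \<Rightarrow> bool" where
  "bicompatible n u v \<longleftrightarrow> compatible n u v \<and> compatible n v u"

definition bicompatible_subgroup :: "nat \<Rightarrow> (nat \<times> nat \<Rightarrow> nat \<times> nat) set \<Rightarrow> bool" where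
  "bicompatible_subgroup n S \<longleftrightarrow>
     subgroup S (sym_group_on (pairs n)) \<and> (\<forall>u \<in> S. \<forall>v \<in> S. bicompatible n u v)"

text \<open>
  The list of the elements of a finite set \<open>A\<close>, strictly increasing with respect to the
  (reflexive) linear order \<open>r\<close>.
\<close>

definition enum_by :: "('a \<times> 'a) set \<Rightarrow> 'a set \<Rightarrow> 'a list" where
  "enum_by r A = (THE xs. set xs = A \<and> sorted_wrt (\<lambda>x y. (x, y) \<in> r \<and> x \<noteq> y) xs)"

text \<open>
  The cycles multiplied in \<open>c0\<close> and \<open>r0\<close> have disjoint supports, so the order of the factors,
  for which we take that of \<open>r\<close>, does not matter.
\<close>

definition c0 :: "(nat \<times> nat) set \<Rightarrow> nat set \<Rightarrow> nat \<times> nat \<Rightarrow> nat \<times> nat" where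
  "c0 r C = foldr (\<circ>)
     (map (\<lambda>y. cycle_of_list (map (\<lambda>x. (x, y)) (enum_by r C))) (enum_by r C)) id"

definition r0 :: "(nat \<times> nat) set \<Rightarrow> nat set \<Rightarrow> nat \<times> nat \<Rightarrow> nat \<times> nat" where
  "r0 r B = foldr (\<circ>)
     (map (\<lambda>x. cycle_of_list (map (\<lambda>y. (x, y)) (enum_by r B))) (enum_by r B)) id"

definition N_set ::
    "nat \<Rightarrow> nat set \<Rightarrow> nat set \<Rightarrow> (nat \<times> nat) set \<Rightarrow> (nat \<times> nat \<Rightarrow> nat \<times> nat) set" where
  "N_set m B C r =
     generate (sym_group_on (pairs (2 * m))) ({c0 r C, r0 r B} \<union> {p. p permutes (C \<times> B)})"

end

theory Submission
  imports Defs
begin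

text \<open>
  The sets \<open>C \<times> C\<close>, \<open>B \<times> B\<close> and \<open>C \<times> B\<close> are pairwise disjoint, and the generators
  \<open>c\<^sub>0\<close>, \<open>r\<^sub>0\<close> and \<open>S(C \<times> B)\<close> are supported on one of them each. Hence every element of
  \<open>N(B,C)\<close> is determined by a power of an \<open>m\<close>-cycle on \<open>C\<close>, a power of an \<open>m\<close>-cycle on \<open>B\<close> and
  a permutation of \<open>C \<times> B\<close>, with independent multiplication. It acts on a pair \<open>(x, y)\<close> by
  moving \<open>x\<close> only within its block and not at all unless \<open>x \<in> C\<close>, and \<open>y\<close> only within its block
  and not at all unless \<open>y \<in> B\<close>; moreover its effect on \<open>x\<close> is the same for all \<open>y \<in> C\<close>, and
  its effect on \<open>y\<close> is the same for all \<open>x \<in> B\<close>. The middle coordinate of a triple is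
  therefore changed by at most one of the two factors in the definition of compatibility, and the
  other factor does not notice the change.
\<close>

section \<open>Enumeration of a set along a linear order\<close>

text \<open>If the heads differed, each would lie in the tail of the other list and so precede the
  other, against asymmetry. Equal heads occur in neither tail, so the tails have the same
  set.\<close>

lemma sorted_wrt_unique:
  assumes "sorted_wrt P xs" "sorted_wrt P ys" "set xs = set ys"
    and asym: "\<And>x y. P x y \<Longrightarrow> \<not> P y x"
  shows "xs = ys"
  using assms(1-3)
proof (induction xs arbitrary: ys)
  case Nil
  then show ?case by simp
next
  case (Cons x xs)
  then obtain y zs where ys: "ys = y # zs"
    by (cases ys) auto
  have "x = y"
  proof (rule ccontr)
    assume "x \<noteq> y"
    then have "P y x" "P x y"
      using Cons.prems ys by auto
    then show False
      using asym by blast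
  qed
  moreover have "x \<notin> set xs" "y \<notin> set zs"
    using Cons.prems(1,2) ys asym by force+
  ultimately have "set xs = set zs"
    using Cons.prems(3) ys by auto
  then show ?case
    using Cons ys \<open>x = y\<close> by simp
qed

lemma ex_sorted_wrt_strict:
  assumes r: "linear_order_on D r" and "finite A" "A \<subseteq> D"
  shows "\<exists>xs. set xs = A \<and> sorted_wrt (\<lambda>x y. (x, y) \<in> r \<and> x \<noteq> y) xs"
  using assms(2,3)
proof (induction A rule: finite_induct)
  case empty
  then show ?case by simp
next
  case (insert a A)
  let ?P = "\<lambda>x y. (x, y) \<in> r \<and> x \<noteq> y"
  obtain xs where xs: "set xs = A" "sorted_wrt ?P xs"
    using insert by auto
  have tr: "trans r" and an: "antisym r" and tot: "total_on D r"
    using r by (auto simp: linear_order_on_def partial_order_on_def preorder_on_def)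
  let ?ys = "filter (\<lambda>x. ?P x a) xs @ a # filter (\<lambda>x. \<not> ?P x a) xs"
  \<comment> \<open>Since \<open>a\<close> is new to \<open>A\<close>, any \<open>x\<close> in
    \<open>A\<close> differs from it, and totality leaves only \<open>a\<close> before
    \<open>x\<close>. Hence \<open>a\<close> separates the two filtered parts of
    \<open>?ys\<close>.\<close>
  have above: "?P a x" if "x \<in> A" "\<not> ?P x a" for x
    using that tot insert.hyps insert.prems by (auto simp: total_on_def)
  have P_trans: "?P x z" if "?P x y" "?P y z" for x y z
    using that tr an by (meson antisymD transD)
  have "?P x z" if "?P x a" "z \<in> A" "\<not> ?P z a" for x z
    by (rule P_trans[OF that(1) above[OF that(2,3)]])
  then have "sorted_wrt ?P ?ys"
    unfolding sorted_wrt_append sorted_wrt.simps(2) set_filter list.set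
    using xs above by (intro conjI sorted_wrt_filter) blast+
  moreover have "set ?ys = insert a A"
    using xs by auto
  ultimately show ?case by blast
qed

text \<open>Existence and uniqueness of the sorted list make the definite description meaningful;
  cycles then need its set of entries and the absence of repetitions.\<close>

lemma enum_by:
  assumes r: "linear_order_on D r" and "finite A" "A \<subseteq> D"
  shows set_enum_by: "set (enum_by r A) = A" and distinct_enum_by: "distinct (enum_by r A)"
proof -
  let ?P = "\<lambda>x y. (x, y) \<in> r \<and> x \<noteq> y"
  have asym: "\<not> ?P y x" if "?P x y" for x y
    using that r by (auto simp: linear_order_on_def partial_order_on_def dest: antisymD)
  have "\<exists>!xs. set xs = A \<and> sorted_wrt ?P xs"
    using ex_sorted_wrt_strict[OF assms] sorted_wrt_unique[of ?P, OF _ _ _ asym]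
    by (metis (no_types, lifting))
  then have *: "set (enum_by r A) = A \<and> sorted_wrt ?P (enum_by r A)"
    unfolding enum_by_def by (rule theI')
  then show "set (enum_by r A) = A" by simp
  have "distinct xs" if "sorted_wrt ?P xs" for xs
    using that by (induction xs) auto
  then show "distinct (enum_by r A)"
    using * by blast
qed

section \<open>Cycles\<close>

text \<open>A cycle is a product of transpositions, and an injective relabelling carries
  transpositions to transpositions.\<close>

lemma cycle_of_list_map_inj:
  assumes "inj f"
  shows "cycle_of_list (map f xs) (f a) = f (cycle_of_list xs a)"
proof (induction xs rule: cycle_of_list.induct)
  case (1 i j cs)
  then show ?case
    using assms by (simp add: transpose_def inj_eq)
qed simp_all

text \<open>The factors have disjoint supports, one for each second coordinate, so at
  \<open>(a, b)\<close> at most the factor belonging to \<open>b\<close> acts, and it keeps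
  \<open>b\<close>.\<close>

lemma foldr_cycles_row:
  assumes "distinct ys"
  shows "foldr (\<circ>) (map (\<lambda>y. cycle_of_list (map (\<lambda>x. (x, y)) xs)) ys) id =
    (\<lambda>(a, b). if b \<in> set ys then (cycle_of_list xs a, b) else (a, b))"
  using assms
proof (induction ys)
  case Nil
  then show ?case by (simp add: fun_eq_iff)
next
  case (Cons y ys)
  have "cycle_of_list (map (\<lambda>x. (x, y)) xs) (a, y) = (cycle_of_list xs a, y)" for a
    by (rule cycle_of_list_map_inj) (simp add: inj_on_def)
  moreover have "cycle_of_list (map (\<lambda>x. (x, y)) xs) (a, b) = (a, b)" if "b \<noteq> y" for a b
    using that by (intro id_outside_supp) auto
  ultimately have "cycle_of_list (map (\<lambda>x. (x, y)) xs) (a, b) =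
      (if b = y then cycle_of_list xs a else a, b)" for a b
    by simp
  then show ?case
    using Cons by (auto simp: fun_eq_iff)
qed

lemma foldr_cycles_column:
  assumes "distinct xs"
  shows "foldr (\<circ>) (map (\<lambda>x. cycle_of_list (map (\<lambda>y. (x, y)) ys)) xs) id =
    (\<lambda>(a, b). if a \<in> set xs then (a, cycle_of_list ys b) else (a, b))"
  using assms
proof (induction xs)
  case Nil
  then show ?case by (simp add: fun_eq_iff)
next
  case (Cons x xs)
  have "cycle_of_list (map (\<lambda>y. (x, y)) ys) (x, b) = (x, cycle_of_list ys b)" for b
    by (rule cycle_of_list_map_inj) (simp add: inj_on_def)
  moreover have "cycle_of_list (map (\<lambda>y. (x, y)) ys) (a, b) = (a, b)" if "a \<noteq> x" for a b
    using that by (intro id_outside_supp) auto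
  ultimately have "cycle_of_list (map (\<lambda>y. (x, y)) ys) (a, b) =
      (a, if a = x then cycle_of_list ys b else b)" for a b
    by simp
  then show ?case
    using Cons by (auto simp: fun_eq_iff)
qed

text \<open>The first entry tells the powers apart: the \<open>k\<close>-th power sends it to the
  entry with index \<open>k\<close>.\<close>

lemma funpow_cycle_inj:
  assumes "distinct cs" "i < length cs" "j < length cs"
    and "cycle_of_list cs ^^ i = cycle_of_list cs ^^ j"
  shows "i = j"
proof -
  have pow: "(cycle_of_list cs ^^ k) (cs ! 0) = cs ! k" if "k < length cs" for k
  proof -
    have "0 < length cs"
      using that by linarith
    then have "(cycle_of_list cs ^^ k) (cs ! 0) = map (cycle_of_list cs ^^ k) cs ! 0"
      by simp
    also have "\<dots> = cs ! k"
      using assms(1) that \<open>0 < length cs\<close> by (simp add: cyclic_rotation nth_rotate)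
    finally show ?thesis .
  qed
  have "cs ! i = cs ! j"
    using assms(4) pow[OF assms(2)] pow[OF assms(3)] by simp
  then show ?thesis
    using assms(1-3) by (simp add: nth_eq_iff_index_eq)
qed

lemma funpow_cycle_mod:
  assumes "distinct cs"
  shows "cycle_of_list cs ^^ (k mod length cs) = cycle_of_list cs ^^ k"
  using cycle_is_id_root[OF assms] by (auto simp: fun_eq_iff intro!: funpow_mod_eq)

lemma funpow_cycle_permutes: "cycle_of_list cs ^^ k permutes set cs"
proof (induction k)
  case 0
  then show ?case
    by (simp only: funpow.simps permutes_id)
next
  case (Suc k)
  then show ?case
    unfolding funpow.simps by (rule permutes_compose[OF _ cycle_permutes])
qed

lemma funpow_cycle_add_mod:
  assumes "distinct cs" "0 \<le> i" "0 \<le> j"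
  shows "cycle_of_list cs ^^ nat ((i + j) mod int (length cs)) =
    (cycle_of_list cs ^^ nat i) \<circ> (cycle_of_list cs ^^ nat j)"
  using assms
  by (simp add: nat_mod_distrib nat_add_distrib funpow_cycle_mod funpow_add)

section \<open>Symmetric groups\<close>

lemma sym_group_on_simps [simp]:
  "carrier (sym_group_on A) = {p. p permutes A}"
  "mult (sym_group_on A) = (\<circ>)"
  "one (sym_group_on A) = id"
  by (simp_all add: sym_group_on_def)

lemma group_sym_group_on: "group (sym_group_on A)"
proof (rule groupI)
  show "\<exists>q \<in> carrier (sym_group_on A). q \<otimes>\<^bsub>sym_group_on A\<^esub> p = \<one>\<^bsub>sym_group_on A\<^esub>"
    if "p \<in> carrier (sym_group_on A)" for p
    using that by (intro bexI[of _ "inv_into UNIV p"]) (simp_all add: permutes_inv permutes_inv_o)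
qed (auto simp: permutes_id intro: permutes_compose)

lemma sym_group_on_iso:
  assumes f: "bij_betw f A B"
  shows "sym_group_on A \<cong> sym_group_on B"
proof -
  \<comment> \<open>Conjugation by \<open>f\<close>, extended by the identity outside
    \<open>B\<close>.\<close>
  define h where "h = (\<lambda>p x. if x \<in> B then f (p (inv_into A f x)) else x)"
  have "bij_betw h {p. p permutes A} {p. p permutes B}"
    unfolding h_def by (rule bij_betw_permutations[OF f])
  moreover have "h (p \<circ> q) = h p \<circ> h q" if "p permutes A" "q permutes A" for p q
  proof
    fix x
    have "f (q (inv_into A f x)) \<in> B \<and> inv_into A f (f (q (inv_into A f x))) = q (inv_into A f x)"
      if "x \<in> B"
    proof -
      have "inv_into A f x \<in> A"
        using that f by (metis bij_betw_def inv_into_into)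
      then have "q (inv_into A f x) \<in> A"
        using \<open>q permutes A\<close> by (simp add: permutes_in_image)
      then show ?thesis
        using f by (auto simp: bij_betw_def)
    qed
    then show "h (p \<circ> q) x = (h p \<circ> h q) x"
      by (simp add: h_def)
  qed
  ultimately have "h \<in> iso (sym_group_on A) (sym_group_on B)"
    by (simp add: iso_def hom_def bij_betw_imp_funcset)
  then show ?thesis
    by (rule is_isoI)
qed

lemma sym_group_on_iso_sym_group:
  assumes "finite A"
  shows "sym_group_on A \<cong> sym_group (card A)"
proof -
  obtain f where "bij_betw f A {1..card A}"
    using finite_same_card_bij[OF assms, of "{1..card A}"] by auto
  then show ?thesis
    using sym_group_on_iso by (simp only: sym_group_on_def sym_group_def)
qed

section \<open>Permutations built from the three blocks\<close>

text \<open>The last branch serves both \<open>C \<times> B\<close>, where \<open>s\<close> is meant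
  to act, and all remaining pairs, which any \<open>s\<close> permuting \<open>C \<times> B\<close>
  fixes.\<close>

definition block_perm ::
    "'a set \<Rightarrow> 'a set \<Rightarrow> ('a \<Rightarrow> 'a) \<Rightarrow> ('a \<Rightarrow> 'a) \<Rightarrow> ('a \<times> 'a \<Rightarrow> 'a \<times> 'a) \<Rightarrow> 'a \<times> 'a \<Rightarrow> 'a \<times> 'a" where
  "block_perm B C f g s = (\<lambda>(x, y).
     if x \<in> C \<and> y \<in> C then (f x, y) else if x \<in> B \<and> y \<in> B then (x, g y) else s (x, y))"

locale two_blocks =
  fixes B C :: "'a set"
  assumes disj: "B \<inter> C = {}"
begin

lemma permutes_Times_cases:
  assumes "s permutes C \<times> B"
  obtains x' y' where "x \<in> C" "x \<notin> B" "y \<in> B" "y \<notin> C"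
      "x' \<in> C" "x' \<notin> B" "y' \<in> B" "y' \<notin> C" "s (x, y) = (x', y')"
    | "\<not> (x \<in> C \<and> y \<in> B)" "s (x, y) = (x, y)"
proof (cases "(x, y) \<in> C \<times> B")
  case True
  moreover obtain x' y' where s: "s (x, y) = (x', y')"
    by fastforce
  ultimately have "(x', y') \<in> C \<times> B"
    using permutes_in_image[OF assms, of "(x, y)"] by simp
  with True s disj show ?thesis
    by (intro that(1)) auto
next
  case False
  then show ?thesis
    using permutes_not_in[OF assms] by (intro that(2)) auto
qed

text \<open>The inner map keeps every block invariant, so the outer map is evaluated in the same
  branch and the three components multiply independently.\<close>

lemma block_perm_comp:
  assumes "f' permutes C" "g' permutes B" "s' permutes C \<times> B"
  shows "block_perm B C f g s \<circ> block_perm B C f' g' s' =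
    block_perm B C (f \<circ> f') (g \<circ> g') (s \<circ> s')"
proof
  fix p :: "'a \<times> 'a"
  obtain x y where p: "p = (x, y)" by fastforce
  have f': "f' x \<in> C \<longleftrightarrow> x \<in> C" and g': "g' y \<in> B \<longleftrightarrow> y \<in> B"
    using assms by (simp_all add: permutes_in_image)
  show "(block_perm B C f g s \<circ> block_perm B C f' g' s') p =
    block_perm B C (f \<circ> f') (g \<circ> g') (s \<circ> s') p"
    using disj
    by (cases rule: permutes_Times_cases[OF assms(3), of x y])
      (simp_all add: p block_perm_def f' g')
qed

lemma block_perm_id [simp]: "block_perm B C id id id = id"
  by (auto simp: block_perm_def fun_eq_iff)

text \<open>Inverting the three components gives a two-sided inverse by
  \<open>block_perm_comp\<close>.\<close>

lemma block_perm_permutes: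
  assumes "f permutes C" "g permutes B" "s permutes C \<times> B" and "B \<union> C \<subseteq> A"
  shows "block_perm B C f g s permutes A \<times> A"
proof -
  let ?p = "block_perm B C f g s"
    and ?q = "block_perm B C (inv_into UNIV f) (inv_into UNIV g) (inv_into UNIV s)"
  have "?p \<circ> ?q = id" "?q \<circ> ?p = id"
    using assms by (simp_all add: block_perm_comp permutes_inv permutes_inv_o)
  then have "bij ?p"
    by (metis o_bij)
  moreover have "?p z = z" if "z \<notin> A \<times> A" for z
  proof -
    obtain x y where z: "z = (x, y)" by fastforce
    show ?thesis
      using that assms(4)
      by (cases rule: permutes_Times_cases[OF assms(3), of x y]) (auto simp: z block_perm_def)
  qed
  ultimately show ?thesis
    by (simp add: permutes_def bij_iff)
qed

text \<open>Each component is read off on its own block; for \<open>f\<close> and \<open>g\<close>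
  this takes one fixed element of \<open>C\<close> or \<open>B\<close> as the other
  coordinate.\<close>

lemma block_perm_inject:
  assumes f: "f permutes C" "f' permutes C" and g: "g permutes B" "g' permutes B"
    and s: "s permutes C \<times> B" "s' permutes C \<times> B"
    and "B \<noteq> {}" "C \<noteq> {}"
    and eq: "block_perm B C f g s = block_perm B C f' g' s'"
  shows "f = f' \<and> g = g' \<and> s = s'"
proof (intro conjI ext)
  obtain b c where "b \<in> B" "c \<in> C"
    using assms by blast
  show "f x = f' x" for x
  proof (cases "x \<in> C")
    case True
    then show ?thesis
      using fun_cong[OF eq, of "(x, c)"] \<open>c \<in> C\<close> by (simp add: block_perm_def)
  qed (simp add: f[THEN permutes_not_in])
  show "g y = g' y" for y
  proof (cases "y \<in> B")
    case True
    moreover have "b \<notin> C"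
      using \<open>b \<in> B\<close> disj by auto
    ultimately show ?thesis
      using fun_cong[OF eq, of "(b, y)"] \<open>b \<in> B\<close> by (simp add: block_perm_def)
  qed (simp add: g[THEN permutes_not_in])
  show "s z = s' z" for z
  proof (cases "z \<in> C \<times> B")
    case True
    then obtain x y where "z = (x, y)" "x \<in> C" "y \<in> B"
      by auto
    moreover from this have "x \<notin> B" "y \<notin> C"
      using disj by auto
    ultimately show ?thesis
      using fun_cong[OF eq, of z] by (simp add: block_perm_def)
  qed (simp add: s[THEN permutes_not_in])
qed

end

lemma compatible_block_perm:
  assumes "B \<inter> C = {}" "{1..n} \<subseteq> B \<union> C"
    and "f permutes C" "g permutes B" and s: "s permutes C \<times> B"
    and "f' permutes C" "g' permutes B" and s': "s' permutes C \<times> B"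
  shows "compatible n (block_perm B C f g s) (block_perm B C f' g' s')"
proof -
  interpret two_blocks B C
    using assms by unfold_locales
  have in_blocks: "f x \<in> C \<longleftrightarrow> x \<in> C" "g x \<in> B \<longleftrightarrow> x \<in> B"
      "f' x \<in> C \<longleftrightarrow> x \<in> C" "g' x \<in> B \<longleftrightarrow> x \<in> B" for x
    using assms by (simp_all add: permutes_in_image)
  have fixed: "s (x, y) = (x, y)" "s' (x, y) = (x, y)" if "x \<notin> C \<or> y \<notin> B" for x y
    using that s s' by (auto simp: permutes_not_in)
  let ?u = "block_perm B C f g s" and ?v = "block_perm B C f' g' s'"
  have "(tensor_one ?v \<circ> one_tensor ?u) (x, y, z) = (one_tensor ?u \<circ> tensor_one ?v) (x, y, z)"
    if "x \<in> B \<union> C" "y \<in> B \<union> C" "z \<in> B \<union> C" for x y z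
  proof (cases "y \<in> C")
    case True
    then have y: "y \<notin> B"
      using disj by auto
    \<comment> \<open>Here \<open>x'\<close> is the same for all \<open>w\<close> in
      \<open>C\<close>: \<open>?v\<close> keeps the middle coordinate and acts on \<open>x\<close>
      alike before and after \<open>?u\<close> has moved \<open>y\<close> within
      \<open>C\<close>.\<close>
    obtain x' where v: "?v (x, w) = (x', w)" if "w \<in> C" for w
    proof
      show "?v (x, w) = (if x \<in> C then f' x else x, w)" if "w \<in> C" for w
        using that disj fixed by (auto simp: block_perm_def)
    qed
    have "fst (?u (y, z)) \<in> C"
      by (cases rule: permutes_Times_cases[OF s, of y z])
        (simp_all add: block_perm_def in_blocks True y)
    then obtain y' z' where u: "?u (y, z) = (y', z')" "y' \<in> C"
      by (cases "?u (y, z)") simp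
    show ?thesis
      by (simp add: tensor_one_def one_tensor_def u v True)
  next
    case False
    then have y: "y \<in> B"
      using that by auto
    \<comment> \<open>The mirror case: \<open>?v\<close> may move \<open>y\<close> within
      \<open>B\<close>, and \<open>?u\<close> keeps the middle coordinate and sends \<open>z\<close>
      to the same \<open>z'\<close> throughout.\<close>
    obtain z' where u: "?u (w, z) = (w, z')" if "w \<in> B" for w
    proof
      show "?u (w, z) = (w, if z \<in> B then g z else z)" if "w \<in> B" for w
        using that disj fixed by (auto simp: block_perm_def)
    qed
    have "snd (?v (x, y)) \<in> B"
      by (cases rule: permutes_Times_cases[OF s', of x y])
        (simp_all add: block_perm_def in_blocks False y)
    then obtain x' y' where v: "?v (x, y) = (x', y')" "y' \<in> B"
      by (cases "?v (x, y)") simp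
    show ?thesis
      by (simp add: tensor_one_def one_tensor_def u v y)
  qed
  then show ?thesis
    using assms(2) by (auto simp: compatible_def subset_iff)
qed

section \<open>The group generated by the three blocks\<close>

locale cycle_blocks =
  fixes bs cs :: "'a list" and A :: "'a set"
  assumes distinct: "distinct bs" "distinct cs"
    and disjoint: "set bs \<inter> set cs = {}"
    and nonempty: "bs \<noteq> []" "cs \<noteq> []"
    and covered: "set bs \<union> set cs \<subseteq> A"
begin

sublocale two_blocks "set bs" "set cs"
  by unfold_locales (rule disjoint)

abbreviation param_group where
  "param_group \<equiv> sym_group_on (set cs \<times> set bs) \<times>\<times>
     (integer_mod_group (length cs) \<times>\<times> integer_mod_group (length bs))"

text \<open>The exponents are integers because \<open>integer_mod_group\<close> consists of integer
  residues; \<open>s\<close> comes first to match the order of the factors in the target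
  group.\<close>

definition param :: "('a \<times> 'a \<Rightarrow> 'a \<times> 'a) \<times> int \<times> int \<Rightarrow> 'a \<times> 'a \<Rightarrow> 'a \<times> 'a" where
  "param = (\<lambda>(s, i, j). block_perm (set bs) (set cs)
     (cycle_of_list cs ^^ nat i) (cycle_of_list bs ^^ nat j) s)"

text \<open>Nonempty lists matter here: \<open>integer_mod_group 0\<close> is the group of all
  integers.\<close>

lemma carrier_param_group:
  "carrier param_group =
    {s. s permutes set cs \<times> set bs} \<times> {0..<int (length cs)} \<times> {0..<int (length bs)}"
  using nonempty by (simp add: carrier_integer_mod_group)

lemma group_hom_param: "group_hom param_group (sym_group_on (A \<times> A)) param"
proof -
  have "param \<in> hom param_group (sym_group_on (A \<times> A))"
    unfolding hom_def carrier_param_group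
    using distinct covered
    by (auto simp: param_def block_perm_comp funpow_cycle_permutes funpow_cycle_add_mod
        block_perm_permutes)
  moreover have "group param_group" "group (sym_group_on (A \<times> A))"
    by (simp_all add: DirProd_group group_sym_group_on)
  ultimately show ?thesis
    by (simp add: group_hom_def group_hom_axioms_def)
qed

lemma inj_on_param: "inj_on param (carrier param_group)"
proof (rule inj_onI)
  fix p q
  assume p_in: "p \<in> carrier param_group" and q_in: "q \<in> carrier param_group"
    and eq: "param p = param q"
  obtain s i j s' i' j' where p: "p = (s, i, j)" and q: "q = (s', i', j')"
    by (cases p, cases q) blast
  have s: "s permutes set cs \<times> set bs" "s' permutes set cs \<times> set bs"
    and ij: "i \<in> {0..<int (length cs)}" "j \<in> {0..<int (length bs)}"
      "i' \<in> {0..<int (length cs)}" "j' \<in> {0..<int (length bs)}"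
    using p_in q_in unfolding p q carrier_param_group by simp_all
  have "cycle_of_list cs ^^ nat i = cycle_of_list cs ^^ nat i' \<and>
      cycle_of_list bs ^^ nat j = cycle_of_list bs ^^ nat j' \<and> s = s'"
    using eq s nonempty unfolding param_def p q
    by (intro block_perm_inject) (simp_all add: funpow_cycle_permutes)
  then have "nat i = nat i'" "nat j = nat j'" "s = s'"
    using ij distinct by (auto intro: funpow_cycle_inj)
  then show "p = q"
    using ij p q by (simp add: eq_nat_nat_iff)
qed

text \<open>The image of a homomorphism is a subgroup, and it contains the generators. Conversely,
  each value of \<open>param\<close> is a power of \<open>?c\<close> times a power of
  \<open>?r\<close> times an element of \<open>?S\<close>.\<close>

lemma image_param_eq_generate:
  "param ` carrier param_group = generate (sym_group_on (A \<times> A))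
    ({block_perm (set bs) (set cs) (cycle_of_list cs) id id,
      block_perm (set bs) (set cs) id (cycle_of_list bs) id} \<union>
     {s. s permutes set cs \<times> set bs})"
  (is "_ = generate ?G ({?c, ?r} \<union> ?S)")
proof
  interpret group_hom param_group ?G param
    by (rule group_hom_param)
  have id [simp]: "id permutes X" for X :: "'b set"
    by (rule permutes_id)
  have block_s: "block_perm (set bs) (set cs) id id s = s" if "s permutes set cs \<times> set bs" for s
  proof
    fix p :: "'a \<times> 'a"
    obtain x y where "p = (x, y)" by fastforce
    then show "block_perm (set bs) (set cs) id id s p = s p"
      using disjoint by (cases rule: permutes_Times_cases[OF that, of x y])
        (auto simp: block_perm_def)
  qed
  \<comment> \<open>For a cycle of length 1 the exponent 1 is out of range, hence the reduction.\<close>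
  have "?c = param (id, 1 mod int (length cs), 0)" "?r = param (id, 0, 1 mod int (length bs))"
    using distinct funpow_cycle_mod[of cs 1] funpow_cycle_mod[of bs 1]
    by (simp_all add: param_def nat_mod_distrib)
  moreover have "s = param (s, 0, 0)" if "s \<in> ?S" for s
    using block_s that by (simp add: param_def)
  ultimately have "{?c, ?r} \<union> ?S \<subseteq> param ` carrier param_group"
    using nonempty unfolding carrier_param_group
    by (auto intro!: image_eqI[where f = param])
  then show "generate ?G ({?c, ?r} \<union> ?S) \<subseteq> param ` carrier param_group"
    using img_is_subgroup by (intro H.generate_subgroup_incl)
  let ?N = "generate ?G ({?c, ?r} \<union> ?S)"
  have one: "id \<in> ?N"
    using generate.one[of ?G] unfolding sym_group_on_simps by blast
  have mult: "p \<circ> q \<in> ?N" if "p \<in> ?N" "q \<in> ?N" for p q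
    using generate.eng[OF that] unfolding sym_group_on_simps .
  have pow_c: "block_perm (set bs) (set cs) (cycle_of_list cs ^^ k) id id \<in> ?N" for k
  proof (induction k)
    case 0
    show ?case
      unfolding funpow.simps block_perm_id by (rule one)
  next
    case (Suc k)
    have "?c \<circ> block_perm (set bs) (set cs) (cycle_of_list cs ^^ k) id id =
        block_perm (set bs) (set cs) (cycle_of_list cs ^^ Suc k) id id"
      by (simp add: block_perm_comp funpow_cycle_permutes)
    moreover have "?c \<in> ?N"
      by (intro generate.incl) blast
    ultimately show ?case
      using mult[of ?c, OF _ Suc] by (simp only:)
  qed
  have pow_r: "block_perm (set bs) (set cs) id (cycle_of_list bs ^^ k) id \<in> ?N" for k
  proof (induction k)
    case 0
    show ?case
      unfolding funpow.simps block_perm_id by (rule one)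
  next
    case (Suc k)
    have "?r \<circ> block_perm (set bs) (set cs) id (cycle_of_list bs ^^ k) id =
        block_perm (set bs) (set cs) id (cycle_of_list bs ^^ Suc k) id"
      by (simp add: block_perm_comp funpow_cycle_permutes)
    moreover have "?r \<in> ?N"
      by (intro generate.incl) blast
    ultimately show ?case
      using mult[of ?r, OF _ Suc] by (simp only:)
  qed
  show "param ` carrier param_group \<subseteq> generate ?G ({?c, ?r} \<union> ?S)"
  proof (unfold carrier_param_group, clarify)
    fix s i j
    assume s: "s permutes set cs \<times> set bs"
    \<comment> \<open>By \<open>block_s\<close> the bare \<open>s\<close> is the block permutation
      with two identity components, so all three factors multiply componentwise.\<close>
    have "param (s, i, j) =
      block_perm (set bs) (set cs) (cycle_of_list cs ^^ nat i) id id \<circ>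
      (block_perm (set bs) (set cs) id (cycle_of_list bs ^^ nat j) id \<circ> s)"
      using s block_perm_comp[of id id s, unfolded block_s[OF s]]
      by (simp add: param_def block_perm_comp funpow_cycle_permutes flip: o_assoc)
    also have "\<dots> \<in> ?N"
      using s by (intro mult pow_c pow_r generate.incl) blast
    finally show "param (s, i, j) \<in> ?N" .
  qed
qed

end

section \<open>The given generators as block permutations, and the theorem\<close>

lemma c0_eq_block_perm:
  assumes "set (enum_by r C) = C" "distinct (enum_by r C)" "B \<inter> C = {}"
  shows "c0 r C = block_perm B C (cycle_of_list (enum_by r C)) id id"
  \<comment> \<open>\<open>foldr_cycles_row\<close> also applies the cycle to first coordinates
    outside \<open>C\<close>; these lie off its support and stay fixed.\<close>
  using assms id_outside_supp[of _ "enum_by r C"]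
  by (auto simp: c0_def foldr_cycles_row block_perm_def fun_eq_iff)

lemma r0_eq_block_perm:
  assumes "set (enum_by r B) = B" "distinct (enum_by r B)" "B \<inter> C = {}"
  shows "r0 r B = block_perm B C id (cycle_of_list (enum_by r B)) id"
  using assms id_outside_supp[of _ "enum_by r B"]
  by (auto simp: r0_def foldr_cycles_column block_perm_def fun_eq_iff)

theorem theorem4p6:
  fixes m :: nat and B C :: "nat set" and r :: "(nat \<times> nat) set"
  assumes "m \<ge> 1"
    and "C \<subseteq> {1..2 * m}" and "card C = m"
    and "B = {1..2 * m} - C"
    and "linear_order_on {1..2 * m} r"
  shows "bicompatible_subgroup (2 * m) (N_set m B C r) \<and>
    (sym_group_on (pairs (2 * m)))\<lparr>carrier := N_set m B C r\<rparr> \<cong>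
      sym_group (m\<^sup>2) \<times>\<times> (integer_mod_group m \<times>\<times> integer_mod_group m)"
proof
  have fin: "finite B" "finite C"
    using assms by (auto intro: finite_subset)
  have card_B: "card B = m"
    using assms fin by (simp add: card_Diff_subset)
  have B_C: "B \<inter> C = {}" and sub: "B \<subseteq> {1..2 * m}" and cover: "{1..2 * m} \<subseteq> B \<union> C"
    using assms by auto
  define bs cs where "bs = enum_by r B" and "cs = enum_by r C"
  have bs: "set bs = B" "distinct bs" and cs: "set cs = C" "distinct cs"
    unfolding bs_def cs_def
    by (intro set_enum_by[OF assms(5)] distinct_enum_by[OF assms(5)] fin sub assms(2))+
  have len: "length bs = m" "length cs = m"
    using bs cs card_B assms(3) by (simp_all flip: distinct_card)
  interpret cycle_blocks bs cs "{1..2 * m}"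
    using bs cs len B_C sub assms by unfold_locales auto
  let ?G = "sym_group_on (pairs (2 * m))"
  interpret hom: group_hom param_group ?G param
    by (rule group_hom_param)
  \<comment> \<open>From here on, elements of \<open>N(B,C)\<close> are handled through their
    parameters.\<close>
  have N: "N_set m B C r = param ` carrier param_group"
    unfolding image_param_eq_generate N_set_def
    using c0_eq_block_perm[of r C B] r0_eq_block_perm[of r B C] B_C bs cs
    by (simp add: bs_def cs_def)
  have powers: "cycle_of_list cs ^^ k permutes C" "cycle_of_list bs ^^ k permutes B" for k
    using funpow_cycle_permutes[of k cs] funpow_cycle_permutes[of k bs] bs cs by simp_all
  have "compatible (2 * m) (param p) (param q)"
    if "p \<in> carrier param_group" "q \<in> carrier param_group" for p q
  proof -
    obtain s i j s' i' j' where p: "p = (s, i, j)" and q: "q = (s', i', j')"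
      by (cases p, cases q) blast
    have "s permutes C \<times> B" "s' permutes C \<times> B"
      using that unfolding p q carrier_param_group bs cs by simp_all
    then show ?thesis
      unfolding p q param_def prod.case bs cs
      by (intro compatible_block_perm B_C cover powers)
  qed
  \<comment> \<open>Compatibility was shown for arbitrary ordered pairs, so exchanging
    \<open>p\<close> and \<open>q\<close> yields the other direction.\<close>
  then show "bicompatible_subgroup (2 * m) (N_set m B C r)"
    unfolding bicompatible_subgroup_def bicompatible_def N
    using hom.img_is_subgroup by auto
  \<comment> \<open>An injective homomorphism is an isomorphism onto its image, which is
    \<open>N(B,C)\<close> by \<open>N\<close>.\<close>
  have "param \<in> iso param_group (?G\<lparr>carrier := N_set m B C r\<rparr>)"
    unfolding iso_def bij_betw_def N
    using hom.homh inj_on_param by (auto simp: hom_def)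
  then have "?G\<lparr>carrier := N_set m B C r\<rparr> \<cong> param_group"
    by (rule group.iso_sym[OF hom.G.is_group is_isoI])
  also have "param_group \<cong> sym_group (m\<^sup>2) \<times>\<times> (integer_mod_group m \<times>\<times> integer_mod_group m)"
    unfolding len bs cs
  proof (rule group.DirProd_iso_trans[OF group_sym_group_on _ iso_refl])
    show "sym_group_on (C \<times> B) \<cong> sym_group (m\<^sup>2)"
      using sym_group_on_iso_sym_group[of "C \<times> B"] fin card_B assms(3)
      by (simp add: card_cartesian_product power2_eq_square)
  qed
  finally show "?G\<lparr>carrier := N_set m B C r\<rparr> \<cong>
      sym_group (m\<^sup>2) \<times>\<times> (integer_mod_group m \<times>\<times> integer_mod_group m)" .
qed

end
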